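(* Let $s,t \geq 1$ be integers and let $\alpha_{s,t}$ be the type-$\alpha$ comb with $s$ teeth of length $t$. Then exactly one linear extension of $\alpha_{s,t}$ avoids the pattern $132$.
   Context: A linear extension of a finite poset $P$ on a set of integers is a listing $v=[v_1,\dots,v_n]$ of all elements of $P$, each exactly once, such that whenever $a \leq_P b$, $a$ appears before $b$. For $w \in S_3$, a sequence $v$ of distinct integers contains $w$ if there are indices $i<j<k$ with $(v_i,v_j,v_k)$ in the same relative order as $(w_1,w_2,w_3)$; otherwise $v$ avoids $w$. The type-$\alpha$ comb $\alpha_{s,t}$ is the poset on $\{1,\dots,st\}$ whose order is generated by the relations $i \leq i+1$ for $1 \leq i \leq s-1$ (the spine $1,\dots,s$) and $x \leq x+s$ for $1 \leq x \leq (t-1)s$ (so the teeth are $c, c+s, \dots, c+(t-1)s$ for $1\le c\le s$). *)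

theory Defs
  imports Main
begin

definition linear_extension :: "'a set \<Rightarrow> ('a \<times> 'a) set \<Rightarrow> 'a list \<Rightarrow> bool" where
  "linear_extension A r v \<longleftrightarrow> distinct v \<and> set v = A \<and>
     (\<forall>i < length v. \<forall>j < length v. (v ! i, v ! j) \<in> r \<and> v ! i \<noteq> v ! j \<longrightarrow> i < j)"

definition same_relative_order :: "'a::linorder list \<Rightarrow> 'b::linorder list \<Rightarrow> bool" where
  "same_relative_order xs ys \<longleftrightarrow> length xs = length ys \<and>
     (\<forall>i < length xs. \<forall>j < length xs. xs ! i < xs ! j \<longleftrightarrow> ys ! i < ys ! j)"

text \<open>Patterns are permutations in one-line notation; only length 3 is relevant:
  for a list \<open>w\<close> of any other length the predicate is false.\<close>

definition contains_pattern3 :: "'a::linorder list \<Rightarrow> nat list \<Rightarrow> bool" where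
  "contains_pattern3 v w \<longleftrightarrow>
     (\<exists>i j k. i < j \<and> j < k \<and> k < length v \<and> same_relative_order [v ! i, v ! j, v ! k] w)"

definition avoids_pattern3 :: "'a::linorder list \<Rightarrow> nat list \<Rightarrow> bool" where
  "avoids_pattern3 v w \<longleftrightarrow> \<not> contains_pattern3 v w"

definition alpha_comb_gen :: "nat \<Rightarrow> nat \<Rightarrow> (nat \<times> nat) set" where
  "alpha_comb_gen s t =
     {(i, i + 1) | i. 1 \<le> i \<and> i \<le> s - 1} \<union> {(x, x + s) | x. 1 \<le> x \<and> x \<le> (t - 1) * s}"

text \<open>The closure is cut down to the ground set because \<open>rtrancl\<close> is reflexive on
  the whole type.\<close>

definition alpha_comb :: "nat \<Rightarrow> nat \<Rightarrow> (nat \<times> nat) set" where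
  "alpha_comb s t = (alpha_comb_gen s t)\<^sup>* \<inter> ({1..s * t} \<times> {1..s * t})"

lemma alpha_comb_gen_subset:
  assumes "s \<ge> 1" "t \<ge> 1"
  shows "alpha_comb_gen s t \<subseteq> {1..s * t} \<times> {1..s * t}"
proof -
  obtain t' where t: "t = Suc t'" using assms(2) by (cases t) auto
  show ?thesis using assms(1) unfolding alpha_comb_gen_def t
    by (auto simp: algebra_simps intro: trans_le_add1)
qed

lemma alpha_comb_le: "(a, b) \<in> alpha_comb s t \<Longrightarrow> a \<le> b"
proof -
  assume "(a, b) \<in> alpha_comb s t"
  then have "(a, b) \<in> (alpha_comb_gen s t)\<^sup>*" by (simp add: alpha_comb_def)
  then show "a \<le> b"
    by (induction rule: rtrancl_induct) (auto simp: alpha_comb_gen_def)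
qed

lemma alpha_comb_partial_order: "partial_order_on {1..s * t} (alpha_comb s t)"
  unfolding partial_order_on_def preorder_on_def
proof (intro conjI)
  show "refl_on {1..s * t} (alpha_comb s t)" by (auto simp: refl_on_def alpha_comb_def)
  show "trans (alpha_comb s t)"
    unfolding trans_def alpha_comb_def by (auto intro: rtrancl_trans)
  show "antisym (alpha_comb s t)"
    by (auto intro!: antisymI order.antisym dest: alpha_comb_le)
qed (auto simp: alpha_comb_def)

end

(* The element 1 is the least element of the comb, so every linear extension starts with 1.
   A descent further on would then form a 132 together with this initial 1; hence the only
   candidate is the increasing listing, which is a linear extension because the comb order
   is contained in the usual order of the integers. *)
theory Submission
  imports Defs
begin

lemma same_relative_order_132_iff:
  "same_relative_order [a, b, c] [1, 3, 2 :: nat] \<longleftrightarrow> a < c \<and> c < b"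
  by (auto simp: same_relative_order_def less_Suc_eq numeral_eq_Suc)

lemma contains_132_iff:
  "contains_pattern3 v [1, 3, 2] \<longleftrightarrow>
     (\<exists>i j k. i < j \<and> j < k \<and> k < length v \<and> v ! i < v ! k \<and> v ! k < v ! j)"
  unfolding contains_pattern3_def same_relative_order_132_iff ..

lemma sorted_avoids_132:
  assumes "sorted v"
  shows "avoids_pattern3 v [1, 3, 2]"
  unfolding avoids_pattern3_def contains_132_iff
proof (intro notI, elim exE conjE)
  fix i j k
  assume "j < k" "k < length v" "v ! k < v ! j"
  with sorted_nth_mono[OF assms, of j k] show False by simp
qed

text \<open>Two distinct elements related by \<open>r\<close> are strictly increasing, and in a
  sorted list the smaller one stands first. Only \<open>r\<close> being contained in the linear
  order matters.\<close>

lemma linear_extension_sorted_list: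
  fixes v :: "'a::linorder list"
  assumes "sorted v" "distinct v" and le: "\<And>a b. (a, b) \<in> r \<Longrightarrow> a \<le> b"
  shows "linear_extension (set v) r v"
  unfolding linear_extension_def
proof (intro conjI allI impI)
  fix i j
  assume "i < length v" "j < length v" and *: "(v ! i, v ! j) \<in> r \<and> v ! i \<noteq> v ! j"
  then have "v ! i < v ! j" using le by force
  with \<open>i < length v\<close> sorted_nth_mono[OF \<open>sorted v\<close>, of j i] show "i < j"
    by (meson leD not_le_imp_less)
qed (use assms in auto)

text \<open>Otherwise \<open>m\<close> sits at some position \<open>k\<close>, and comparing it with
  the entry at position 0 would force \<open>k < 0\<close>.\<close>

lemma linear_extension_nth_0:
  assumes v: "linear_extension A r v" and "m \<in> A" and least: "\<And>x. x \<in> A \<Longrightarrow> (m, x) \<in> r"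
  shows "v ! 0 = m"
proof (rule ccontr)
  assume ne: "v ! 0 \<noteq> m"
  obtain k where k: "k < length v" "v ! k = m"
    using v \<open>m \<in> A\<close> by (auto simp: linear_extension_def in_set_conv_nth)
  have "0 < length v" using k by linarith
  then have "v ! 0 \<in> A" using v by (auto simp: linear_extension_def)
  then have "(v ! k, v ! 0) \<in> r \<and> v ! k \<noteq> v ! 0" using least k ne by simp
  then have "k < 0" using v k(1) \<open>0 < length v\<close> unfolding linear_extension_def by blast
  then show False by simp
qed

lemma sorted_of_avoids_132:
  assumes av: "avoids_pattern3 v [1, 3, 2]" and "distinct v"
    and least: "\<And>x. x \<in> set v \<Longrightarrow> v ! 0 \<le> x"
  shows "sorted v"
  unfolding sorted_iff_nth_mono_less
proof (intro allI impI)
  fix i j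
  assume ij: "i < j" "j < length v"
  show "v ! i \<le> v ! j"
  proof (rule ccontr)
    assume gt: "\<not> v ! i \<le> v ! j"
    with least ij have "0 < i" by (cases i) auto
    \<comment> \<open>Distinctness makes the minimality of \<open>v ! 0\<close> strict, so positions
      0, \<open>i\<close>, \<open>j\<close> carry a 132.\<close>
    have "v ! 0 \<noteq> v ! j" using \<open>distinct v\<close> ij by (subst nth_eq_iff_index_eq) auto
    with least ij have "v ! 0 < v ! j" by (simp add: less_le)
    with \<open>0 < i\<close> ij gt have "contains_pattern3 v [1, 3, 2]"
      unfolding contains_132_iff by (meson not_le)
    with av show False by (simp add: avoids_pattern3_def)
  qed
qed

text \<open>Descend from \<open>x\<close> along its tooth in steps of \<open>s\<close> until the
  spine is reached, then along the spine to 1. The strong induction peels off the last such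
  generator.\<close>

lemma alpha_comb_least:
  assumes "1 \<le> s" "x \<in> {1..s * t}"
  shows "(1, x) \<in> alpha_comb s t"
proof -
  have "1 \<le> x \<Longrightarrow> x \<le> s * t \<Longrightarrow> (1, x) \<in> (alpha_comb_gen s t)\<^sup>*"
  proof (induction x rule: less_induct)
    case (less x)
    consider "x = 1" | "1 < x" "x \<le> s" | "s < x" using less.prems by linarith
    then show ?case
    proof cases
      case 2
      then have "(x - 1, x) \<in> alpha_comb_gen s t"
        unfolding alpha_comb_gen_def by (auto intro!: exI[of _ "x - 1"])
      moreover have "(1, x - 1) \<in> (alpha_comb_gen s t)\<^sup>*" using less 2 by simp
      ultimately show ?thesis by (rule rtrancl_into_rtrancl[rotated])
    next
      case 3
      have "x - s \<le> (t - 1) * s"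
        using less.prems by (cases t) (auto simp: mult.commute)
      with 3 have "(x - s, x) \<in> alpha_comb_gen s t"
        unfolding alpha_comb_gen_def by (intro UnI2 CollectI exI[of _ "x - s"]) simp
      \<comment> \<open>\<open>1 <= s\<close> gives \<open>x - s < x\<close>, as the induction
        requires.\<close>
      moreover have "(1, x - s) \<in> (alpha_comb_gen s t)\<^sup>*" using less 3 assms(1) by simp
      ultimately show ?thesis by (rule rtrancl_into_rtrancl[rotated])
    qed simp
  qed
  \<comment> \<open>For \<open>t = 0\<close> the ground set is empty; otherwise 1 lies in it, so the
    pair survives the restriction.\<close>
  then show ?thesis using assms by (cases t) (auto simp: alpha_comb_def)
qed

theorem theorem4:
  fixes s t :: nat
  assumes "s \<ge> 1" and "t \<ge> 1"
  shows "\<exists>!v. linear_extension {1..s * t} (alpha_comb s t) v \<and> avoids_pattern3 v [1, 3, 2]"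
proof (rule ex1I)
  let ?w = "sorted_list_of_set {1..s * t}"
  have "linear_extension (set ?w) (alpha_comb s t) ?w"
    by (rule linear_extension_sorted_list) (auto dest: alpha_comb_le)
  then show "linear_extension {1..s * t} (alpha_comb s t) ?w \<and> avoids_pattern3 ?w [1, 3, 2]"
    using sorted_avoids_132[OF sorted_sorted_list_of_set] by simp
  fix v
  assume v: "linear_extension {1..s * t} (alpha_comb s t) v \<and> avoids_pattern3 v [1, 3, 2]"
  then have dv: "distinct v" "set v = {1..s * t}" by (auto simp: linear_extension_def)
  have "v ! 0 = 1"
    by (rule linear_extension_nth_0[OF conjunct1[OF v] _ alpha_comb_least[OF assms(1)]])
      (use assms in simp_all)
  with v dv have "sorted v" by (intro sorted_of_avoids_132) auto
  \<comment> \<open>A sorted distinct list is determined by its set of entries.\<close>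
  with dv show "v = ?w" by (metis sorted_list_of_set.idem_if_sorted_distinct)
qed

end
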